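(* Let $d\in\mathbb N$ and $\alpha\in\mathbb Q$ be such that $\alpha\notin-(1+(d+1)\mathbb N)$ and $(d,\alpha)\ne(0,0)$. Let $D=\partial_t+\alpha t^{-1}-t^d$. Then $\mathfrak r(\mathrm{Im}'D)=\{0\}$, where $\mathrm{Im}'D:=\mathbb C[t]\cap D(\mathbb C[t])$.
   Context: $\mathbb N$ includes $0$, and $-(1+(d+1)\mathbb N)=\{-(1+(d+1)q): q\in\mathbb N\}$. The operator $D$ acts as $f\mapsto f'+\alpha t^{-1}f-t^d f$ from $\mathbb C[t]$ to $\mathbb C[t,t^{-1}]$. For a subset $V$ of $\mathbb C[t]$, $\mathfrak r(V)=\{f\in\mathbb C[t] : f^m\in V\text{ for all sufficiently large } m\}$. *)

theory Defs
  imports Complex_Main "HOL-Computational_Algebra.Computational_Algebra"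
begin

text \<open>
  The ring \<open>\<complex>[t,t\<inverse>]\<close> is realised inside the library's ring
  \<open>\<complex>((t))\<close> of formal Laurent series. The set \<open>laurent_polys\<close> and the lemmas about it
  record that the operator \<open>D\<close> takes its values in \<open>\<complex>[t,t\<inverse>]\<close>.
\<close>

definition fls_of_poly :: "'a::comm_semiring_1 poly \<Rightarrow> 'a fls" where
  "fls_of_poly p = fps_to_fls (fps_of_poly p)"

lemma inj_fls_of_poly: "inj fls_of_poly"
  by (rule injI) (simp add: fls_of_poly_def fps_of_poly_eq_iff)

definition laurent_polys :: "'a::comm_semiring_1 fls set" where
  "laurent_polys = {fls_X_inv ^ n * fls_of_poly p | n p. True}"

definition D_op :: "nat \<Rightarrow> rat \<Rightarrow> complex poly \<Rightarrow> complex fls" where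
  "D_op d \<alpha> f =
     fls_of_poly (pderiv f) + fls_const (of_rat \<alpha>) * fls_X_inv * fls_of_poly f
       - fls_X ^ d * fls_of_poly f"

lemma fls_deriv_fls_of_poly: "fls_deriv (fls_of_poly f) = fls_of_poly (pderiv f)"
  for f :: "complex poly"
  by (simp add: fls_of_poly_def fls_deriv_fps_to_fls fps_of_poly_pderiv)

lemma D_op_eq:
  "D_op d \<alpha> f = fls_X_inv *
     fls_of_poly (monom 1 1 * pderiv f + smult (of_rat \<alpha>) f - monom 1 (Suc d) * f)"
proof -
  have XX: "fls_X * (fls_X_inv * g) = g" for g :: "complex fls"
    by (simp add: fls_X_inv_times_conv_shift fls_X_times_conv_shift)
  show ?thesis
    by (simp add: D_op_def fls_of_poly_def fps_of_poly_add fps_of_poly_diff fps_of_poly_mult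
        fps_of_poly_monom fps_of_poly_smult fls_times_fps_to_fls fps_to_fls_power
        fps_X_def [symmetric] algebra_simps XX)
qed

lemma D_op_in_laurent_polys: "D_op d \<alpha> f \<in> laurent_polys"
  unfolding laurent_polys_def D_op_eq by (metis (mono_tags, lifting) mem_Collect_eq power_one_right)

definition Im'_D :: "nat \<Rightarrow> rat \<Rightarrow> complex poly set" where
  "Im'_D d \<alpha> = {g. fls_of_poly g \<in> range (D_op d \<alpha>)}"

lemma fls_of_poly_image_Im'_D:
  "fls_of_poly ` Im'_D d \<alpha> = range fls_of_poly \<inter> range (D_op d \<alpha>)"
  by (auto simp: Im'_D_def)

definition poly_radical :: "complex poly set \<Rightarrow> complex poly set" where
  "poly_radical V = {f. \<exists>N. \<forall>m\<ge>N. f ^ m \<in> V}"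

end

theory Submission
  imports Defs
begin

text \<open>
  Write \<open>L\<close> for the linear functional on \<open>\<complex>[t]\<close> that sends \<open>t\<^sup>n\<close> to \<open>0\<close> if \<open>d + 1\<close> does not
  divide \<open>n\<close>, and sends \<open>t\<close> to the power \<open>(d + 1) q\<close> to the product \<open>c q\<close> of the numbers
  \<open>(d + 1) j + 1 + \<alpha>\<close> over \<open>j < q\<close>. Applying \<open>D\<close> to \<open>t\<close> raised to \<open>(d + 1) q + 1\<close> shows that the
  recursion \<open>c (q + 1) = ((d + 1) q + 1 + \<alpha>) c q\<close> is exactly what makes \<open>L\<close> vanish on the
  polynomials in the image of \<open>D\<close>; the pair \<open>(0, 0)\<close> is excluded because there \<open>D 1 = -1\<close>, although
  \<open>L 1 = 1\<close>. The non-resonance condition on \<open>\<alpha>\<close> says that no \<open>c q\<close> vanishes. So it is enough to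
  refute \<open>L (f\<^sup>m) = 0\<close> for one large \<open>m\<close>, for each \<open>f \<noteq> 0\<close>.

  This is done modulo a prime. Write \<open>f = t\<^sup>k h\<close> with \<open>b = h(0) \<noteq> 0\<close>, take \<open>m = (d + 1) p\<close> with
  \<open>p\<close> a large prime, and let \<open>A\<close> be a subring of \<open>\<complex>\<close> that contains the coefficients of \<open>h\<close> and the
  inverse of the denominator of \<open>\<alpha>\<close>. The lowest term of \<open>f\<^sup>m\<close> is \<open>b\<^sup>m\<close> in degree
  \<open>(d + 1) k p\<close>. After division by \<open>c (k p)\<close>, the equation \<open>L (f\<^sup>m) = 0\<close> equates \<open>- b\<^sup>m\<close> with a
  sum over \<open>q > k p\<close> of coefficients of \<open>f\<^sup>m\<close> times \<open>c q / c (k p)\<close>, and each summand lies in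
  \<open>p A\<close>: if \<open>p\<close> does not divide \<open>q\<close>, the coefficient does, because the derivative of \<open>f\<^sup>m\<close> is
  divisible by \<open>p\<close>; if \<open>p\<close> divides \<open>q\<close>, then \<open>q \<ge> k p + p\<close>, and among any \<open>p\<close> consecutive
  factors \<open>(d + 1) j + 1 + \<alpha>\<close> one lies in \<open>p A\<close>. Hence \<open>b\<^sup>m\<close> lies in \<open>p A\<close>
  (\<open>lowest_coeff_power_multiple_of_prime\<close>).

  This is absurd for large \<open>p\<close>: a finitely generated \<open>A\<close> has the property that only finitely many
  primes divide some power of a given nonzero element
  (\<open>finite_subset_subring_few_prime_divisors\<close>). For \<open>\<int>\<close> this is clear, and it is passed on
  from \<open>A\<close> to \<open>A[b]\<close> by comparing leading coefficients if \<open>b\<close> is transcendental over \<open>A\<close>, and by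
  pseudo-division by a polynomial of least degree vanishing at \<open>b\<close> if it is algebraic.
\<close>

section \<open>Subrings and polynomials over them\<close>

definition subring :: "'a::comm_ring_1 set \<Rightarrow> bool" where
  "subring A \<longleftrightarrow> 1 \<in> A \<and> (\<forall>x\<in>A. \<forall>y\<in>A. x - y \<in> A \<and> x * y \<in> A)"

lemma subring_one: "subring A \<Longrightarrow> 1 \<in> A"
  and subring_diff: "subring A \<Longrightarrow> x \<in> A \<Longrightarrow> y \<in> A \<Longrightarrow> x - y \<in> A"
  and subring_mult: "subring A \<Longrightarrow> x \<in> A \<Longrightarrow> y \<in> A \<Longrightarrow> x * y \<in> A"
  by (auto simp: subring_def)

lemma subring_zero: "subring A \<Longrightarrow> 0 \<in> A"
  using subring_diff[of A 1 1] subring_one by auto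

lemma subring_uminus: "subring A \<Longrightarrow> x \<in> A \<Longrightarrow> - x \<in> A"
  using subring_diff[of A 0 x] subring_zero by auto

lemma subring_add: "subring A \<Longrightarrow> x \<in> A \<Longrightarrow> y \<in> A \<Longrightarrow> x + y \<in> A"
  using subring_diff[of A x "- y"] subring_uminus by auto

lemma subring_of_nat: "subring A \<Longrightarrow> of_nat n \<in> A"
  by (induction n) (auto simp: subring_zero subring_one subring_add)

lemma subring_of_int: "subring A \<Longrightarrow> of_int n \<in> A"
  by (cases n) (auto simp: subring_of_nat subring_diff subring_uminus subring_one)

lemma subring_sum: "subring A \<Longrightarrow> (\<And>i. i \<in> I \<Longrightarrow> f i \<in> A) \<Longrightarrow> sum f I \<in> A"
  by (induction I rule: infinite_finite_induct) (auto simp: subring_zero subring_add)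

lemma subring_prod: "subring A \<Longrightarrow> (\<And>i. i \<in> I \<Longrightarrow> f i \<in> A) \<Longrightarrow> prod f I \<in> A"
  by (induction I rule: infinite_finite_induct) (auto simp: subring_one subring_mult)

lemma subring_power: "subring A \<Longrightarrow> x \<in> A \<Longrightarrow> x ^ n \<in> A"
  by (induction n) (auto simp: subring_one subring_mult)

lemmas subring_intros = subring_zero subring_one subring_diff subring_mult subring_uminus
  subring_add subring_of_nat subring_of_int subring_sum subring_prod subring_power

definition poly_over :: "'a::comm_ring_1 set \<Rightarrow> 'a poly set" where
  "poly_over A = {p. \<forall>i. coeff p i \<in> A}"

lemma coeff_poly_over: "p \<in> poly_over A \<Longrightarrow> coeff p i \<in> A"
  by (simp add: poly_over_def)

lemma subring_poly_over: "subring A \<Longrightarrow> subring (poly_over A)"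
  unfolding subring_def [of "poly_over A"]
  by (auto simp: poly_over_def coeff_mult intro!: subring_intros)

lemma monom_poly_over: "subring A \<Longrightarrow> c \<in> A \<Longrightarrow> monom c n \<in> poly_over A"
  by (auto simp: poly_over_def subring_zero)

lemma const_poly_over: "subring A \<Longrightarrow> c \<in> A \<Longrightarrow> [:c:] \<in> poly_over A"
  using monom_poly_over[of A c 0] by (simp add: monom_0)

lemma smult_poly_over: "subring A \<Longrightarrow> c \<in> A \<Longrightarrow> p \<in> poly_over A \<Longrightarrow> smult c p \<in> poly_over A"
  by (auto simp: poly_over_def subring_mult)

lemma pderiv_poly_over:
  fixes A :: "'a::{idom, ring_char_0} set"
  shows "subring A \<Longrightarrow> p \<in> poly_over A \<Longrightarrow> pderiv p \<in> poly_over A"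
  by (auto simp: poly_over_def coeff_pderiv simp del: of_nat_Suc intro!: subring_intros)

lemma poly_in_subring:
  assumes "subring A" "p \<in> poly_over A" "x \<in> A"
  shows "poly p x \<in> A"
  unfolding poly_altdef using assms by (auto intro!: subring_intros coeff_poly_over)

text \<open>
  The usual long division, except that each step first multiplies by the leading coefficient of the
  divisor, so that no inverses are needed and all coefficients stay in \<open>A\<close>.
\<close>

lemma pseudo_division_over:
  fixes h :: "'a::idom poly"
  assumes A: "subring A" and h: "h \<in> poly_over A" "h \<noteq> 0" and g: "g \<in> poly_over A"
  obtains N q r where "q \<in> poly_over A" "r \<in> poly_over A"
    "smult (lead_coeff h ^ N) g = q * h + r" "r = 0 \<or> degree r < degree h"
proof -
  note PA = subring_poly_over[OF A]
  have "\<exists>N. \<exists>q\<in>poly_over A. \<exists>r\<in>poly_over A.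
      smult (lead_coeff h ^ N) g = q * h + r \<and> (r = 0 \<or> degree r < degree h)"
    using g
  proof (induction "degree g" arbitrary: g rule: less_induct)
    case less
    show ?case
    proof (cases "degree g < degree h")
      case True
      show ?thesis
        by (rule exI[of _ 0], rule bexI[of _ 0], rule bexI[of _ g])
           (use True less.prems PA in \<open>auto intro: subring_zero\<close>)
    next
      case ge: False
      show ?thesis
      proof (cases "degree h = 0")
        case True
        then obtain c where c: "h = [:c:]" by (auto elim: degree_eq_zeroE)
        show ?thesis
          by (rule exI[of _ 1], rule bexI[of _ g], rule bexI[of _ 0])
             (use less.prems PA in \<open>auto intro: subring_zero simp: c\<close>)
      next
        case False
        define m where "m = monom (lead_coeff g) (degree g - degree h)"
        define g' where "g' = smult (lead_coeff h) g - m * h"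
        have m: "m \<in> poly_over A"
          unfolding m_def by (intro monom_poly_over A coeff_poly_over less.prems)
        have g': "g' \<in> poly_over A" unfolding g'_def
          by (intro subring_diff PA subring_mult smult_poly_over A coeff_poly_over h less.prems m)
        have "degree (m * h) \<le> degree g"
          using degree_mult_le[of m h] degree_monom_le[of "lead_coeff g" "degree g - degree h"] ge
          unfolding m_def by linarith
        hence deg: "degree g' \<le> degree g"
          unfolding g'_def by (intro degree_diff_le) auto
        have "coeff (m * h) (degree g) = lead_coeff g * lead_coeff h"
          using ge by (simp add: m_def coeff_monom_mult)
        hence "coeff g' (degree g) = 0" by (simp add: g'_def)
        hence "degree g' < degree g"
          using eq_zero_or_degree_less[OF deg] False ge by auto
        from less.hyps[OF this g'] obtain N q r where *: "q \<in> poly_over A" "r \<in> poly_over A"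
          "smult (lead_coeff h ^ N) g' = q * h + r" "r = 0 \<or> degree r < degree h" by blast
        have "smult (lead_coeff h ^ Suc N) g
            = smult (lead_coeff h ^ N) g' + smult (lead_coeff h ^ N) m * h"
          by (simp add: g'_def smult_diff_right mult.commute)
        also have "\<dots> = (q + smult (lead_coeff h ^ N) m) * h + r"
          using *(3) by (simp add: algebra_simps)
        finally show ?thesis
          using * m by (intro exI[of _ "Suc N"] bexI[of _ "q + smult (lead_coeff h ^ N) m"] bexI[of _ r])
            (auto intro!: subring_add PA smult_poly_over A subring_power coeff_poly_over h)
      qed
    qed
  qed
  thus thesis using that by blast
qed

section \<open>Prime divisors in finitely generated subrings\<close>

definition adjoin :: "'a::comm_ring_1 set \<Rightarrow> 'a \<Rightarrow> 'a set" where
  "adjoin A b = (\<lambda>g. poly g b) ` poly_over A"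

lemma poly_in_adjoin: "g \<in> poly_over A \<Longrightarrow> poly g b \<in> adjoin A b"
  by (simp add: adjoin_def)

lemma subring_adjoin:
  assumes "subring A"
  shows "subring (adjoin A b)"
proof -
  note PA = subring_poly_over[OF assms]
  show ?thesis
    unfolding subring_def[of "adjoin A b"]
  proof (intro conjI ballI)
    show "1 \<in> adjoin A b"
      using poly_in_adjoin[OF subring_one[OF PA], of b] by simp
  next
    fix x y assume "x \<in> adjoin A b" "y \<in> adjoin A b"
    then obtain f g where fg: "f \<in> poly_over A" "g \<in> poly_over A" "x = poly f b" "y = poly g b"
      by (auto simp: adjoin_def)
    show "x - y \<in> adjoin A b"
      using poly_in_adjoin[OF subring_diff[OF PA fg(1,2)], of b] fg by simp
    show "x * y \<in> adjoin A b"
      using poly_in_adjoin[OF subring_mult[OF PA fg(1,2)], of b] fg by simp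
  qed
qed

lemma subset_adjoin: "subring A \<Longrightarrow> A \<subseteq> adjoin A b"
  using poly_in_adjoin[OF const_poly_over, of A _ b] by auto

lemma generator_in_adjoin: "subring A \<Longrightarrow> b \<in> adjoin A b"
  using poly_in_adjoin[OF monom_poly_over[of A 1 1], of b] by (simp add: subring_one poly_monom)

text \<open>
  In a domain \<open>A\<close> of characteristic \<open>0\<close>, a prime \<open>p\<close> belongs to the displayed set exactly if it
  becomes invertible in the localisation \<open>A[1/s]\<close>. Powers of \<open>s\<close> are allowed, instead of \<open>s\<close>
  alone, because the powers of leading coefficients that pseudo-division introduces can then be
  absorbed by changing \<open>s\<close>.
\<close>

definition few_prime_divisors :: "'a::comm_ring_1 set \<Rightarrow> bool" where
  "few_prime_divisors A \<longleftrightarrow>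
     (\<forall>s\<in>A - {0}. finite {p::nat. prime p \<and> (\<exists>n. \<exists>a\<in>A. s ^ n = of_nat p * a)})"

lemma few_prime_divisorsD:
  "few_prime_divisors A \<Longrightarrow> s \<in> A \<Longrightarrow> s \<noteq> 0 \<Longrightarrow>
     finite {p::nat. prime p \<and> (\<exists>n. \<exists>a\<in>A. s ^ n = of_nat p * a)}"
  by (auto simp: few_prime_divisors_def)

lemma few_prime_divisors_Ints: "few_prime_divisors (\<int> :: 'a::{idom, ring_char_0} set)"
  unfolding few_prime_divisors_def
proof
  fix s :: 'a assume "s \<in> \<int> - {0}"
  then obtain z :: int where z: "s = of_int z" "z \<noteq> 0" by (auto elim!: Ints_cases)
  have "{p::nat. prime p \<and> (\<exists>n. \<exists>a\<in>\<int>. s ^ n = of_nat p * a)} \<subseteq> {..nat \<bar>z\<bar>}"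
  proof clarify
    fix p n :: nat and a :: 'a assume p: "prime p" "s ^ n = of_nat p * a" "a \<in> \<int>"
    then obtain y :: int where "a = of_int y" by (auto elim!: Ints_cases)
    with p z have "(of_int (z ^ n) :: 'a) = of_int (int p * y)" by simp
    hence "z ^ n = int p * y" by (simp only: of_int_eq_iff)
    hence "int p dvd z ^ n" by simp
    hence "int p dvd z" using p(1) by (meson prime_dvd_power prime_nat_int_transfer)
    hence "int p \<le> \<bar>z\<bar>" using z(2) by (meson dvd_imp_le_int zdvd_imp_le dvd_abs_iff zero_less_abs_iff)
    thus "p \<le> nat \<bar>z\<bar>" by simp
  qed
  thus "finite {p::nat. prime p \<and> (\<exists>n. \<exists>a\<in>\<int>. s ^ n = of_nat p * a)}"
    by (rule finite_subset) simp
qed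

text \<open>
  Here \<open>A[b]\<close> is a polynomial ring, so an equation \<open>s\<^sup>n = p a\<close> is an identity of polynomials
  and implies the same kind of equation for the leading coefficients, now inside \<open>A\<close>.
\<close>

lemma few_prime_divisors_adjoin_transcendental:
  fixes A :: "'a::{idom, ring_char_0} set"
  assumes "few_prime_divisors A"
    and transc: "\<And>g. g \<in> poly_over A \<Longrightarrow> poly g b = 0 \<Longrightarrow> g = 0"
    and A: "subring A"
  shows "few_prime_divisors (adjoin A b)"
  unfolding few_prime_divisors_def
proof
  note PA = subring_poly_over[OF A]
  fix s assume "s \<in> adjoin A b - {0}"
  then obtain g where g: "g \<in> poly_over A" "s = poly g b" and "s \<noteq> 0"
    by (auto simp: adjoin_def)
  hence "g \<noteq> 0" by auto
  have "{p::nat. prime p \<and> (\<exists>n. \<exists>a\<in>adjoin A b. s ^ n = of_nat p * a)}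
     \<subseteq> {p. prime p \<and> (\<exists>n. \<exists>a\<in>A. lead_coeff g ^ n = of_nat p * a)}"
  proof clarify
    fix p n :: nat and a assume p: "prime p" "s ^ n = of_nat p * a" "a \<in> adjoin A b"
    then obtain u where u: "u \<in> poly_over A" "a = poly u b" by (auto simp: adjoin_def)
    have "g ^ n - of_nat p * u = 0"
      by (rule transc)
         (use p u g in \<open>auto intro!: subring_diff subring_mult subring_power subring_of_nat PA\<close>)
    hence "g ^ n = of_nat p * u" by simp
    hence "lead_coeff (g ^ n) = lead_coeff (of_nat p * u)" by (rule arg_cong)
    hence "lead_coeff g ^ n = of_nat p * lead_coeff u"
      by (simp add: lead_coeff_power lead_coeff_mult of_nat_poly)
    thus "\<exists>n. \<exists>a\<in>A. lead_coeff g ^ n = of_nat p * a"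
      using coeff_poly_over[OF u(1)] by blast
  qed
  moreover have "finite {p::nat. prime p \<and> (\<exists>n. \<exists>a\<in>A. lead_coeff g ^ n = of_nat p * a)}"
    by (rule few_prime_divisorsD) (use assms(1) g \<open>g \<noteq> 0\<close> coeff_poly_over in auto)
  ultimately show "finite {p::nat. prime p \<and> (\<exists>n. \<exists>a\<in>adjoin A b. s ^ n = of_nat p * a)}"
    by (rule finite_subset)
qed

text \<open>
  A substitute for the norm: it replaces an element \<open>s\<close> of \<open>A[b]\<close> by a nonzero multiple in \<open>A\<close>.
  Among the polynomials over \<open>A\<close> whose value at \<open>b\<close> is a nonzero multiple of \<open>s\<close>, one of least
  degree is constant. Otherwise pseudo-division of \<open>h\<close> by it leaves remainder \<open>0\<close>, and the quotient
  vanishes at \<open>b\<close> but has smaller degree than \<open>h\<close>.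
\<close>

lemma adjoin_algebraic_multiple_in_base:
  fixes A :: "'a::{idom, ring_char_0} set"
  assumes A: "subring A" and h: "h \<in> poly_over A" "h \<noteq> 0" "poly h b = 0"
    and min: "\<And>g. g \<in> poly_over A \<Longrightarrow> poly g b = 0 \<Longrightarrow> g = 0 \<or> degree h \<le> degree g"
    and s: "s \<in> adjoin A b" "s \<noteq> 0"
  obtains w where "w \<in> adjoin A b" "s * w \<in> A" "s * w \<noteq> 0"
proof -
  note PA = subring_poly_over[OF A] and B = subring_adjoin[OF A, of b]
  \<comment> \<open>The candidates, among which \<open>m\<close> is chosen of least degree.\<close>
  define Q where "Q m \<longleftrightarrow> m \<in> poly_over A \<and> poly m b \<noteq> 0 \<and> (\<exists>w\<in>adjoin A b. poly m b = s * w)" for m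
  obtain g where "g \<in> poly_over A" "s = poly g b" using s by (auto simp: adjoin_def)
  hence "Q g" using s B by (auto simp: Q_def intro!: bexI[of _ 1] subring_one)
  then obtain m where m: "Q m" and m_min: "\<And>m'. Q m' \<Longrightarrow> degree m \<le> degree m'"
    using exists_least_iff[of "\<lambda>k. \<exists>m. Q m \<and> degree m = k"] by (metis not_le)
  from m obtain w where w: "m \<in> poly_over A" "poly m b \<noteq> 0" "w \<in> adjoin A b" "poly m b = s * w"
    by (auto simp: Q_def)
  have m0: "m \<noteq> 0" using w by auto
  \<comment> \<open>Otherwise the pseudo-remainder of \<open>m\<close> by \<open>h\<close> would be a candidate of smaller degree.\<close>
  have deg_m: "degree m < degree h"
  proof (rule ccontr)
    assume ge: "\<not> degree m < degree h"
    obtain N q r where *: "q \<in> poly_over A" "r \<in> poly_over A"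
      "smult (lead_coeff h ^ N) m = q * h + r" "r = 0 \<or> degree r < degree h"
      using pseudo_division_over[OF A h(1,2) w(1)] .
    from arg_cong[OF *(3), of "\<lambda>p. poly p b"]
    have r: "poly r b = lead_coeff h ^ N * poly m b" using h by simp
    hence "poly r b = s * (lead_coeff h ^ N * w)" using w by simp
    moreover have "lead_coeff h ^ N * w \<in> adjoin A b"
      using subset_adjoin[OF A, of b] coeff_poly_over[OF h(1)] w(3)
      by (intro subring_mult subring_power B) auto
    moreover have nz: "poly r b \<noteq> 0" using r w h by simp
    ultimately have "Q r" using * by (auto simp: Q_def)
    from m_min[OF this] have "degree m \<le> degree r" .
    moreover have "r \<noteq> 0" using nz by auto
    ultimately show False using ge * by auto
  qed
  obtain N q r where *: "q \<in> poly_over A" "r \<in> poly_over A"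
      "smult (lead_coeff m ^ N) h = q * m + r" "r = 0 \<or> degree r < degree m"
    using pseudo_division_over[OF A w(1) m0 h(1)] .
  from arg_cong[OF *(3), of "\<lambda>p. poly p b"]
  have r: "poly r b = s * - (poly q b * w)" using h w
    by (simp add: algebra_simps eq_neg_iff_add_eq_0)
  have "poly r b = 0"
  proof (rule ccontr)
    assume nz: "poly r b \<noteq> 0"
    have "- (poly q b * w) \<in> adjoin A b"
      by (intro subring_uminus subring_mult B poly_in_adjoin * w)
    hence "Q r" unfolding Q_def using nz * r by blast
    from m_min[OF this] * nz show False by auto
  qed
  hence r0: "r = 0" using min[OF *(2)] *(4) deg_m by auto
  hence eq: "smult (lead_coeff m ^ N) h = q * m" using *(3) by simp
  from arg_cong[OF this, of "\<lambda>p. poly p b"] have "poly q b = 0" using w h by simp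
  moreover have q0: "q \<noteq> 0" using eq h m0 by auto
  ultimately have "degree h \<le> degree q" using min[OF *(1)] by auto
  moreover have "degree h = degree q + degree m"
    using arg_cong[OF eq, of degree] m0 q0 by (simp add: degree_mult_eq)
  ultimately have "degree m = 0" by simp
  then obtain c where c: "m = [:c:]" by (auto elim: degree_eq_zeroE)
  have "c \<in> A" using coeff_poly_over[OF w(1), of 0] c by simp
  thus thesis using that[of w] w c by auto
qed

text \<open>
  After passing to a multiple of \<open>s\<close> in \<open>A\<close>, an equation \<open>s\<^sup>n = p u(b)\<close> can be reduced modulo \<open>h\<close>,
  at the cost of a power of the leading coefficient \<open>e\<close> of \<open>h\<close>. By minimality of \<open>h\<close> the powers of
  \<open>b\<close> below its degree are linearly independent over \<open>A\<close>, so the constant terms of both sides agree, and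
  this is an equation in \<open>A\<close> which shows that \<open>p\<close> divides a power of \<open>s e\<close>.
\<close>

lemma few_prime_divisors_adjoin_algebraic:
  fixes A :: "'a::{idom, ring_char_0} set"
  assumes few: "few_prime_divisors A"
    and A: "subring A" and h: "h \<in> poly_over A" "h \<noteq> 0" "poly h b = 0"
    and min: "\<And>g. g \<in> poly_over A \<Longrightarrow> poly g b = 0 \<Longrightarrow> g = 0 \<or> degree h \<le> degree g"
  shows "few_prime_divisors (adjoin A b)"
  unfolding few_prime_divisors_def
proof
  note PA = subring_poly_over[OF A] and B = subring_adjoin[OF A, of b]
  fix s assume "s \<in> adjoin A b - {0}"
  then obtain w where w: "w \<in> adjoin A b" "s * w \<in> A" "s * w \<noteq> 0"
    using adjoin_algebraic_multiple_in_base[OF A h min, of s] by blast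
  define e where "e = lead_coeff h"
  have e: "e \<in> A" "e \<noteq> 0" using coeff_poly_over[OF h(1)] h by (auto simp: e_def)
  have deg_h: "degree h > 0"
    using h by (metis degree_eq_zeroE gr0I pCons_0_0 poly_const_conv)
  have "{p::nat. prime p \<and> (\<exists>n. \<exists>a\<in>adjoin A b. s ^ n = of_nat p * a)}
     \<subseteq> {p. prime p \<and> (\<exists>n. \<exists>a\<in>A. (s * w * e) ^ n = of_nat p * a)}"
  proof clarify
    fix p n :: nat and a assume p: "prime p" "s ^ n = of_nat p * a" "a \<in> adjoin A b"
    have "a * w ^ n \<in> adjoin A b" by (intro subring_mult subring_power B w p)
    then obtain u where u: "u \<in> poly_over A" "a * w ^ n = poly u b" by (auto simp: adjoin_def)
    have swn: "(s * w) ^ n = of_nat p * poly u b"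
      using p(2) u(2) by (simp add: power_mult_distrib mult.assoc)
    obtain N q r where *: "q \<in> poly_over A" "r \<in> poly_over A"
      "smult (e ^ N) u = q * h + r" "r = 0 \<or> degree r < degree h"
      using pseudo_division_over[OF A h(1,2) u(1)] unfolding e_def .
    from arg_cong[OF *(3), of "\<lambda>p. poly p b"] have r: "e ^ N * poly u b = poly r b"
      using h by simp
    define v where "v = [:(s * w) ^ n * e ^ N:] - smult (of_nat p) r"
    have v: "v \<in> poly_over A" unfolding v_def
      by (intro subring_diff PA const_poly_over smult_poly_over A subring_mult subring_power
          subring_of_nat w e *)
    have "degree r < degree h" using *(4) deg_h by auto
    hence "degree v < degree h" unfolding v_def using deg_h
      by (intro degree_diff_less) (auto intro: le_less_trans[OF degree_smult_le])
    moreover have "poly v b = 0" using r swn by (simp add: v_def algebra_simps)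
    ultimately have "v = 0" using min[OF v] by auto
    hence "coeff v 0 = 0" by simp
    hence key: "(s * w) ^ n * e ^ N = of_nat p * coeff r 0" by (simp add: v_def)
    \<comment> \<open>The exponents \<open>n\<close> and \<open>N\<close> are made equal to obtain a power of one element that is independent of \<open>p\<close>.\<close>
    have "(s * w * e) ^ (n + N) = ((s * w) ^ n * e ^ N) * ((s * w) ^ N * e ^ n)"
      by (simp add: power_mult_distrib power_add mult_ac)
    also have "\<dots> = of_nat p * (coeff r 0 * ((s * w) ^ N * e ^ n))"
      by (simp only: key mult.assoc)
    finally show "\<exists>n. \<exists>a\<in>A. (s * w * e) ^ n = of_nat p * a"
      by (intro exI[of _ "n + N"] bexI[of _ "coeff r 0 * ((s * w) ^ N * e ^ n)"])
         (auto intro!: subring_mult[OF A] subring_power[OF A] w(2) e coeff_poly_over *)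
  qed
  moreover have "finite {p::nat. prime p \<and> (\<exists>n. \<exists>a\<in>A. (s * w * e) ^ n = of_nat p * a)}"
    by (rule few_prime_divisorsD) (use few w e subring_mult[OF A w(2) e(1)] in auto)
  ultimately show "finite {p::nat. prime p \<and> (\<exists>n. \<exists>a\<in>adjoin A b. s ^ n = of_nat p * a)}"
    by (rule finite_subset)
qed

lemma few_prime_divisors_adjoin:
  fixes A :: "'a::{idom, ring_char_0} set"
  assumes "few_prime_divisors A" "subring A"
  shows "few_prime_divisors (adjoin A b)"
proof (cases "\<exists>g\<in>poly_over A. poly g b = 0 \<and> g \<noteq> 0")
  case False
  thus ?thesis using few_prime_divisors_adjoin_transcendental assms by blast
next
  case True
  define Q where "Q g \<longleftrightarrow> g \<in> poly_over A \<and> poly g b = 0 \<and> g \<noteq> 0" for g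
  from True obtain h where "Q h" "\<And>g. Q g \<Longrightarrow> degree h \<le> degree g"
    using exists_least_iff[of "\<lambda>k. \<exists>m. Q m \<and> degree m = k"] by (metis not_le Q_def)
  thus ?thesis
    using few_prime_divisors_adjoin_algebraic[OF assms, of h b] by (auto simp: Q_def)
qed

lemma finite_subset_subring_few_prime_divisors:
  fixes S :: "'a::{idom, ring_char_0} set"
  assumes "finite S"
  obtains A where "subring A" "S \<subseteq> A" "few_prime_divisors A"
proof -
  have "\<exists>A. subring A \<and> S \<subseteq> A \<and> few_prime_divisors A" using assms
  proof (induction S rule: finite_induct)
    case empty
    have "subring (\<int> :: 'a set)" by (auto simp: subring_def)
    thus ?case using few_prime_divisors_Ints by blast
  next
    case (insert b S)
    then obtain A where "subring A" "S \<subseteq> A" "few_prime_divisors A" by blast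
    thus ?case
      using subring_adjoin few_prime_divisors_adjoin subset_adjoin generator_in_adjoin
      by (intro exI[of _ "adjoin A b"]) blast
  qed
  thus thesis using that by blast
qed

section \<open>A functional that vanishes on the image\<close>

text \<open>
  For real \<open>\<alpha> > -1\<close> these are, up to normalisation, the moments of order \<open>(d + 1) q\<close> of the weight
  \<open>t\<^sup>\<alpha> exp (- t\<^bsup>d+1\<^esup> / (d + 1))\<close> on the positive axis, against which \<open>D f\<close> integrates
  to boundary terms.
\<close>

definition moment :: "nat \<Rightarrow> rat \<Rightarrow> nat \<Rightarrow> complex" where
  "moment d \<alpha> q = (\<Prod>j<q. of_nat (Suc d * j + 1) + of_rat \<alpha>)"

lemma moment_nonzero:
  assumes "\<alpha> \<notin> {- (1 + (of_nat d + 1) * of_nat q) | q :: nat. True}"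
  shows "moment d \<alpha> q \<noteq> 0"
proof
  assume "moment d \<alpha> q = 0"
  then obtain j where "of_nat (Suc d * j + 1) + of_rat \<alpha> = (0::complex)"
    by (auto simp: moment_def)
  hence "of_rat (of_nat (Suc d * j + 1) + \<alpha>) = (0::complex)"
    by (simp only: of_rat_add of_rat_of_nat_eq)
  hence "of_nat (Suc d * j + 1) + \<alpha> = 0" by (simp only: of_rat_eq_0_iff)
  hence "\<alpha> = - (1 + (of_nat d + 1) * of_nat j)" by (simp add: algebra_simps)
  thus False using assms by blast
qed

lemma moment_split:
  assumes "k \<le> q"
  shows "moment d \<alpha> q = moment d \<alpha> k * (\<Prod>j\<in>{k..<q}. of_nat (Suc d * j + 1) + of_rat \<alpha>)"
proof -
  have "{..<q} = {..<k} \<union> {k..<q}" using assms by auto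
  moreover have "{..<k} \<inter> {k..<q} = {}" by auto
  ultimately show ?thesis unfolding moment_def
    by (metis finite_atLeastLessThan finite_lessThan prod.union_disjoint)
qed

lemma Im'_D_polynomial_identity:
  assumes "g \<in> Im'_D d \<alpha>"
  obtains f where "monom 1 1 * g = monom 1 1 * pderiv f + smult (of_rat \<alpha>) f - monom 1 (Suc d) * f"
proof -
  from assms obtain f where f: "fls_of_poly g = D_op d \<alpha> f" by (auto simp: Im'_D_def)
  define R where "R = monom 1 1 * pderiv f + smult (of_rat \<alpha>) f - monom 1 (Suc d) * f"
  have "fls_of_poly (monom 1 1 * g) = fls_X * fls_of_poly g"
    by (simp add: fls_of_poly_def fps_of_poly_mult fps_of_poly_monom fls_times_fps_to_fls
        fps_X_def [symmetric])
  also have "\<dots> = fls_X * (fls_X_inv * fls_of_poly R)"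
    by (simp only: f D_op_eq R_def)
  also have "\<dots> = fls_of_poly R"
    by (simp add: fls_X_inv_times_conv_shift fls_X_times_conv_shift)
  finally have "monom 1 1 * g = R" using inj_fls_of_poly by (auto dest: injD)
  thus thesis using that by (simp add: R_def)
qed

text \<open>
  By the recursion of the moments, the sum telescopes to a single coefficient of \<open>f\<close>, whose
  index eventually exceeds the degree. The bound \<open>Q0\<close> may be replaced by any larger number, which lets
  a caller choose the range of summation. The initial term of the telescope is \<open>coeff f 0\<close> if
  \<open>d = 0\<close>; it vanishes since \<open>D f\<close> has no pole and \<open>\<alpha> \<noteq> 0\<close>.
\<close>

lemma Im'_D_moment_sum_eq_zero:
  assumes "g \<in> Im'_D d \<alpha>" "(d, \<alpha>) \<noteq> (0, 0)"
  obtains Q0 where "\<And>Q. Q \<ge> Q0 \<Longrightarrow> (\<Sum>q\<le>Q. coeff g (Suc d * q) * moment d \<alpha> q) = 0"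
proof -
  obtain f where f: "monom 1 1 * g = monom 1 1 * pderiv f + smult (of_rat \<alpha>) f - monom 1 (Suc d) * f"
    using Im'_D_polynomial_identity[OF assms(1)] .
  have f0: "of_rat \<alpha> * coeff f 0 = 0"
    using arg_cong[OF f, of "\<lambda>p. coeff p 0"] by (simp add: coeff_monom_mult)
  have coeff_g: "coeff g n = (of_nat (Suc n) + of_rat \<alpha>) * coeff f (Suc n)
      - (if d \<le> n then coeff f (n - d) else 0)" for n
    using arg_cong[OF f, of "\<lambda>p. coeff p (Suc n)"]
    by (simp add: coeff_monom_mult coeff_pderiv ring_distribs del: of_nat_Suc)
  have telescope: "(\<Sum>q\<le>Q. coeff g (Suc d * q) * moment d \<alpha> q)
      = moment d \<alpha> (Suc Q) * coeff f (Suc (Suc d * Q))" for Q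
  proof (induction Q)
    case 0
    have "(if d \<le> 0 then coeff f (0 - d) else 0) = 0" using f0 assms(2) by auto
    thus ?case by (simp add: coeff_g moment_def)
  next
    case (Suc Q)
    have idx: "Suc d * Suc Q - d = Suc (Suc d * Q)" by simp
    have "coeff g (Suc d * Suc Q) = (of_nat (Suc d * Suc Q + 1) + of_rat \<alpha>)
        * coeff f (Suc (Suc d * Suc Q)) - coeff f (Suc (Suc d * Q))"
      unfolding coeff_g idx by simp
    moreover have "moment d \<alpha> (Suc (Suc Q))
        = moment d \<alpha> (Suc Q) * (of_nat (Suc d * Suc Q + 1) + of_rat \<alpha>)"
      by (simp only: moment_def prod.lessThan_Suc)
    ultimately show ?case
      by (simp only: sum.atMost_Suc Suc.IH) (simp only: algebra_simps)
  qed
  show thesis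
  proof (rule that[of "degree f"])
    fix Q assume "Q \<ge> degree f"
    hence "Suc (Suc d * Q) > degree f" by simp
    thus "(\<Sum>q\<le>Q. coeff g (Suc d * q) * moment d \<alpha> q) = 0"
      unfolding telescope by (simp add: coeff_eq_0 del: mult_Suc)
  qed
qed

section \<open>Divisibility by a prime\<close>

lemma multiple_of_prime_if_coprime_multiple:
  fixes A :: "'a::comm_ring_1 set"
  assumes A: "subring A" and "prime p" "\<not> p dvd n" and x: "x \<in> A" and y: "y \<in> A"
    and eq: "of_nat n * x = of_nat p * y"
  obtains z where "z \<in> A" "x = of_nat p * z"
proof -
  have "coprime (int n) (int p)"
    using prime_imp_coprime[OF assms(2,3)] by (simp add: coprime_commute)
  then obtain u v where uv: "u * int n + v * int p = 1"
    using bezout_int[of "int n" "int p"] by auto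
  have "x = of_int (u * int n + v * int p) * x" by (simp only: uv) simp
  also have "\<dots> = of_int u * (of_nat n * x) + of_nat p * (of_int v * x)"
    by (simp add: algebra_simps)
  also have "\<dots> = of_nat p * (of_int u * y + of_int v * x)"
    unfolding eq by (simp add: algebra_simps)
  finally show thesis
    using that[of "of_int u * y + of_int v * x"] by (auto intro!: subring_intros A x y)
qed

text \<open>
  The derivative of \<open>f\<^sup>m\<close> is a multiple of \<open>m\<close>, hence of \<open>p\<close>, while differentiation multiplies the
  coefficient of index \<open>n\<close> by \<open>n\<close>, which is invertible modulo \<open>p\<close>.
\<close>

lemma coeff_power_multiple_of_prime:
  fixes A :: "'a::{idom, ring_char_0} set"
  assumes A: "subring A" and f: "f \<in> poly_over A" and "prime p" "p dvd m" "\<not> p dvd n"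
  obtains z where "z \<in> A" "coeff (f ^ m) n = of_nat p * z"
proof -
  note PA = subring_poly_over[OF A]
  from \<open>p dvd m\<close> obtain l where l: "m = p * l" by blast
  define F where "F = smult (of_nat l) (f ^ (m - 1) * pderiv f)"
  have F: "F \<in> poly_over A" unfolding F_def
    by (intro smult_poly_over A subring_of_nat subring_mult PA subring_power f pderiv_poly_over)
  have d: "pderiv (f ^ m) = smult (of_nat p) F"
    by (simp add: pderiv_power F_def l)
  obtain i where i: "n = Suc i" using assms(5) by (cases n) auto
  have "of_nat n * coeff (f ^ m) n = of_nat p * coeff F i"
    using arg_cong[OF d, of "\<lambda>q. coeff q i"] by (simp add: coeff_pderiv i)
  thus thesis
    using multiple_of_prime_if_coprime_multiple[OF A assms(3,5)] that
      coeff_poly_over[OF F] coeff_poly_over[OF subring_power[OF PA f]] by metis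
qed

lemma prime_divides_progression_term:
  fixes p a :: nat and c :: int
  assumes "prime p" "\<not> p dvd a" 
  obtains j where "k \<le> j" "j < k + p" "int p dvd int a * int j + c"
proof -
  have "coprime (int a) (int p)"
    using prime_imp_coprime[OF assms] by (simp add: coprime_commute)
  then obtain u v where uv: "u * int a + v * int p = 1"
    using bezout_int[of "int a" "int p"] by auto
  \<comment> \<open>The solutions \<open>j\<close> are the integers congruent to \<open>- u c\<close>, and \<open>k + i\<close> is the first one from \<open>k\<close> on.\<close>
  define i where "i = nat ((- u * c - int k) mod int p)"
  have pp: "p > 0" using assms(1) by (rule prime_gt_0_nat)
  have "int i = (- u * c - int k) mod int p" using pp by (simp add: i_def)
  hence "int p dvd int i - (- u * c - int k)" by (simp add: mod_eq_dvd_iff [symmetric])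
  then obtain w where w: "int i - (- u * c - int k) = int p * w" by blast
  hence "int (k + i) = int p * w - u * c" by simp
  hence "int a * int (k + i) + c = int a * (int p * w - u * c) + c" by (simp only:)
  also have "\<dots> = int a * int p * w + c * (1 - u * int a)" by (simp add: algebra_simps)
  also have "1 - u * int a = v * int p" using uv by simp
  finally have "int p dvd int a * int (k + i) + c" by simp
  moreover have "i < p" using pp by (simp add: i_def nat_less_iff)
  ultimately show thesis using that[of "k + i"] by auto
qed

text \<open>
  Multiplied by the denominator \<open>e\<close>, the factors of the moments form an arithmetic progression of
  integers whose difference \<open>e (d + 1)\<close> is prime to \<open>p\<close>, so it meets \<open>p \<int>\<close> in each window of
  length \<open>p\<close>.
\<close>

lemma progression_factor_multiple_of_prime:
  fixes A :: "complex set"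
  assumes A: "subring A" and \<alpha>: "\<alpha> = of_int a / of_nat e" "e > 0" "1 / of_nat e \<in> A"
    and p: "prime p" "\<not> p dvd e * Suc d"
  obtains j z where "k \<le> j" "j < k + p" "z \<in> A"
    "of_nat (Suc d * j + 1) + of_rat \<alpha> = of_nat p * z"
proof -
  obtain j where j: "k \<le> j" "j < k + p" "int p dvd int (e * Suc d) * int j + (int e + a)"
    using prime_divides_progression_term[OF p] .
  then obtain w where w: "int (e * Suc d) * int j + (int e + a) = int p * w" by blast
  have "of_nat (Suc d * j + 1) + of_rat \<alpha>
      = of_int (int (e * Suc d) * int j + (int e + a)) * (1 / of_nat e :: complex)"
    using \<alpha>(2) by (simp add: \<alpha>(1) of_rat_divide field_simps)
  also have "\<dots> = of_nat p * (of_int w * (1 / of_nat e))" unfolding w by simp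
  finally show thesis
    using that[OF j(1,2), of "of_int w * (1 / of_nat e)"] subring_mult[OF A subring_of_int[OF A] \<alpha>(3)]
    by blast
qed

text \<open>
  The exponent \<open>(d + 1) p\<close> serves two purposes: it makes the order of vanishing of the power a multiple
  of \<open>d + 1\<close>, so that the functional sees the lowest coefficient, and it is divisible by \<open>p\<close>, so that
  the coefficients of indices prime to \<open>p\<close> are multiples of \<open>p\<close>.
\<close>

lemma lowest_coeff_power_multiple_of_prime:
  fixes A :: "complex set"
  assumes A: "subring A" and \<alpha>: "\<alpha> = of_int a / of_nat e" "e > 0" "1 / of_nat e \<in> A"
    and nonres: "\<alpha> \<notin> {- (1 + (of_nat d + 1) * of_nat q) | q :: nat. True}" "(d, \<alpha>) \<noteq> (0, 0)"
    and p: "prime p" "\<not> p dvd e * Suc d"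
    and h: "h \<in> poly_over A"
    and mem: "(monom 1 k * h) ^ (Suc d * p) \<in> Im'_D d \<alpha>"
  obtains z where "z \<in> A" "coeff h 0 ^ (Suc d * p) = of_nat p * z"
proof -
  note PA = subring_poly_over[OF A]
  define m where "m = Suc d * p"
  define f where "f = monom 1 k * h"
  \<comment> \<open>For \<open>q \<ge> k p\<close> this is the quotient of the moments of index \<open>q\<close> and \<open>k p\<close>; it is \<open>1\<close> at \<open>q = k p\<close>, where the moment itself may be divisible by \<open>p\<close>.\<close>
  define ratio where
    "ratio q = (\<Prod>j\<in>{k * p..<q}. of_nat (Suc d * j + 1) + of_rat \<alpha> :: complex)" for q
  have f: "f \<in> poly_over A" unfolding f_def
    by (intro subring_mult[OF PA] monom_poly_over A subring_one h)
  have "of_rat \<alpha> = (of_int a * (1 / of_nat e) :: complex)" by (simp add: \<alpha>(1) of_rat_divide)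
  hence \<alpha>A: "of_rat \<alpha> \<in> A" using \<alpha>(3) A by (simp only: subring_mult subring_of_int)
  have ratio_A: "ratio q \<in> A" for q unfolding ratio_def
    by (intro subring_prod A subring_add subring_of_nat \<alpha>A)
  have fm: "f ^ m = monom 1 (Suc d * (k * p)) * h ^ m"
    by (simp add: f_def power_mult_distrib monom_power m_def mult_ac)
  have low: "coeff (f ^ m) (Suc d * q) = 0" if "q < k * p" for q
  proof -
    have "Suc d * q < Suc d * (k * p)" using that by (intro mult_strict_left_mono) auto
    thus ?thesis unfolding fm coeff_monom_mult by simp
  qed
  have lowest: "coeff (f ^ m) (Suc d * (k * p)) = coeff h 0 ^ m"
    unfolding fm coeff_monom_mult by (simp add: coeff_0_power)
  have high: "\<exists>z\<in>A. coeff (f ^ m) (Suc d * q) * ratio q = of_nat p * z" if q: "q > k * p" for q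
  proof (cases "p dvd q")
    case False
    have "\<not> p dvd Suc d * q" using False p by (simp only: prime_dvd_mult_iff) auto
    then obtain z where "z \<in> A" "coeff (f ^ m) (Suc d * q) = of_nat p * z"
      using coeff_power_multiple_of_prime[OF A f p(1), of m "Suc d * q"] by (auto simp: m_def)
    thus ?thesis by (intro bexI[of _ "z * ratio q"]) (auto intro: subring_mult A ratio_A)
  next
    case True
    then obtain s where s: "q = p * s" by blast
    with q have "k < s" by (auto simp: mult.commute)
    hence "p * Suc k \<le> p * s" by (intro mult_le_mono2) simp
    hence window: "k * p + p \<le> q" by (simp add: s algebra_simps)
    obtain j z where j: "k * p \<le> j" "j < k * p + p" "z \<in> A"
      and jz: "of_nat (Suc d * j + 1) + of_rat \<alpha> = of_nat p * z"
      using progression_factor_multiple_of_prime[OF A \<alpha> p, of "k * p"] .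
    define P where "P = (\<Prod>j\<in>{k * p..<q} - {j}. of_nat (Suc d * j + 1) + of_rat \<alpha> :: complex)"
    have "P \<in> A" unfolding P_def
      by (intro subring_prod A subring_add subring_of_nat \<alpha>A)
    have "ratio q = (of_nat p * z) * P"
      unfolding ratio_def P_def jz [symmetric] by (rule prod.remove) (use j window in auto)
    thus ?thesis using \<open>P \<in> A\<close> j(3) coeff_poly_over[OF subring_power[OF PA f]]
      by (intro bexI[of _ "coeff (f ^ m) (Suc d * q) * (z * P)"]) (auto intro!: subring_mult A)
  qed
  then obtain z where z: "\<And>q. q > k * p \<Longrightarrow>
      z q \<in> A \<and> coeff (f ^ m) (Suc d * q) * ratio q = of_nat p * z q" by metis
  obtain Q0 where Q0: "\<And>Q. Q \<ge> Q0 \<Longrightarrow> (\<Sum>q\<le>Q. coeff (f ^ m) (Suc d * q) * moment d \<alpha> q) = 0"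
    using Im'_D_moment_sum_eq_zero[OF mem[folded f_def m_def] nonres(2)] by blast
  define Q where "Q = max Q0 (k * p)"
  have "0 = (\<Sum>q\<le>Q. coeff (f ^ m) (Suc d * q) * moment d \<alpha> q)" using Q0 by (simp add: Q_def)
  also have "\<dots> = (\<Sum>q\<in>{k * p..Q}. coeff (f ^ m) (Suc d * q) * moment d \<alpha> q)"
    by (rule sum.mono_neutral_right) (use low in auto)
  also have "\<dots> = (\<Sum>q\<in>{k * p..Q}. moment d \<alpha> (k * p) * (coeff (f ^ m) (Suc d * q) * ratio q))"
  proof (rule sum.cong)
    fix q assume "q \<in> {k * p..Q}"
    hence "moment d \<alpha> q = moment d \<alpha> (k * p) * ratio q"
      unfolding ratio_def by (intro moment_split) simp
    thus "coeff (f ^ m) (Suc d * q) * moment d \<alpha> q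
        = moment d \<alpha> (k * p) * (coeff (f ^ m) (Suc d * q) * ratio q)"
      by (simp only: mult_ac)
  qed simp
  also have "\<dots> = moment d \<alpha> (k * p) * (\<Sum>q\<in>{k * p..Q}. coeff (f ^ m) (Suc d * q) * ratio q)"
    by (simp only: sum_distrib_left)
  finally have "(\<Sum>q\<in>{k * p..Q}. coeff (f ^ m) (Suc d * q) * ratio q) = 0"
    using moment_nonzero[OF nonres(1)] by simp
  moreover have "{k * p..Q} = insert (k * p) {k * p<..Q}" by (auto simp: Q_def)
  ultimately have "coeff h 0 ^ m + (\<Sum>q\<in>{k * p<..Q}. coeff (f ^ m) (Suc d * q) * ratio q) = 0"
    by (simp add: lowest ratio_def del: mult_Suc)
  also have "(\<Sum>q\<in>{k * p<..Q}. coeff (f ^ m) (Suc d * q) * ratio q)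
      = of_nat p * (\<Sum>q\<in>{k * p<..Q}. z q)"
    unfolding sum_distrib_left by (rule sum.cong) (use z in auto)
  finally have "coeff h 0 ^ m = of_nat p * - (\<Sum>q\<in>{k * p<..Q}. z q)"
    by (simp add: eq_neg_iff_add_eq_0)
  moreover have "- (\<Sum>q\<in>{k * p<..Q}. z q) \<in> A"
    using z by (intro subring_uminus subring_sum A) auto
  ultimately show thesis using that unfolding m_def by blast
qed

section \<open>The radical of the image\<close>

theorem theorem6p2:
  fixes d :: nat and \<alpha> :: rat
  assumes "\<alpha> \<notin> {- (1 + (of_nat d + 1) * of_nat q) | q :: nat. True}"
    and "(d, \<alpha>) \<noteq> (0, 0)"
  shows "poly_radical (Im'_D d \<alpha>) = {0}"
proof
  have "(0::complex poly) \<in> Im'_D d \<alpha>"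
    by (auto simp: Im'_D_def D_op_def fls_of_poly_def intro!: image_eqI[of _ _ 0])
  hence "(0::complex poly) ^ m \<in> Im'_D d \<alpha>" if "m \<ge> 1" for m
    using that by (simp add: power_0_left)
  thus "{0} \<subseteq> poly_radical (Im'_D d \<alpha>)" by (auto simp: poly_radical_def)
next
  show "poly_radical (Im'_D d \<alpha>) \<subseteq> {0}"
  proof (rule ccontr)
    assume "\<not> poly_radical (Im'_D d \<alpha>) \<subseteq> {0}"
    then obtain f N where f: "f \<noteq> 0" and N: "\<And>m. m \<ge> N \<Longrightarrow> f ^ m \<in> Im'_D d \<alpha>"
      by (auto simp: poly_radical_def)
    define k where "k = order 0 f"
    obtain h where "f = [:- 0, 1:] ^ k * h" "\<not> [:- 0, 1:] dvd h"
      using order_decomp[OF f, of 0] unfolding k_def by blast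
    hence fh: "f = monom 1 k * h" and h0: "coeff h 0 \<noteq> 0"
      by (auto simp: monom_altdef dvd_iff_poly_eq_0 poly_0_coeff_0)
    obtain a e where ae: "quotient_of \<alpha> = (a, e)" by (cases "quotient_of \<alpha>")
    have e: "\<alpha> = of_int a / of_nat (nat e)" "nat e > 0"
      using quotient_of_div[OF ae] quotient_of_denom_pos[OF ae] by auto
    define S where "S = insert (1 / of_nat (nat e)) (range (coeff h))"
    have "finite S" by (simp add: S_def range_coeff)
    then obtain A where A: "subring A" "S \<subseteq> A" "few_prime_divisors A"
      using finite_subset_subring_few_prime_divisors by blast
    have h: "h \<in> poly_over A"
      using A(2) unfolding poly_over_def S_def by blast
    define P where "P = {p::nat. prime p \<and> (\<exists>n. \<exists>z\<in>A. coeff h 0 ^ n = of_nat p * z)}"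
    have "finite P"
      unfolding P_def using few_prime_divisorsD[OF A(3) coeff_poly_over[OF h] h0] .
    hence "infinite ({p::nat. prime p} - (P \<union> {..N} \<union> {..nat e * Suc d}))"
      by (intro Diff_infinite_finite primes_infinite finite_UnI finite_atMost)
    then obtain p where "p \<in> {p::nat. prime p} - (P \<union> {..N} \<union> {..nat e * Suc d})"
      using infinite_imp_nonempty by blast
    hence p: "prime p" "p \<notin> P" "p > N" "p > nat e * Suc d" by (simp_all del: mult_Suc_right)
    have "\<not> p dvd nat e * Suc d"
      using p(4) e(2) by (intro nat_dvd_not_less) simp_all
    moreover have "(monom 1 k * h) ^ (Suc d * p) \<in> Im'_D d \<alpha>"
      unfolding fh [symmetric] using p(3) by (intro N) simp
    moreover have "1 / of_nat (nat e) \<in> A" using A(2) by (simp add: S_def)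
    ultimately obtain z where "z \<in> A" "coeff h 0 ^ (Suc d * p) = of_nat p * z"
      using lowest_coeff_power_multiple_of_prime[OF A(1) e _ assms p(1) _ h] by blast
    hence "p \<in> P" unfolding P_def using p(1) by blast
    with p(2) show False ..
  qed
qed

end
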